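(* Let $\mathcal{R}=\mathcal{R}_0\oplus\mathcal{R}_1$ be a supercommutative ring, let $a_2,a_3,\ldots\in\mathcal{R}_0$ and $\beta_1,\beta_2,\ldots\in\mathcal{R}_1$. For $n\ge2$ let $P_n=\mathcal{E}[(\beta_1,\beta_2,\beta_2,\ldots,\beta_{n-1},\beta_{n-1},\beta_n)]$ (word of length $2n-2$), set $P_1=1$, and for $n\ge1$ let $Q_n=\mathcal{E}[(\beta_1,\beta_2,\beta_2,\ldots,\beta_n,\beta_n)]$ (word of length $2n-1$; so $Q_1=\beta_1$), where $\mathcal{E}$ is defined in the context. Then: (i) for all $n\ge 2$, $P_n=-\beta_nQ_{n-1}+P_{n-1}$; (ii) for all $n\ge 2$, $P_n=\det{}_{\mathrm{col}}\, T_n$, where $T_n=(t_{ij})_{1\le i,j\le n}$ is the $n\times n$ matrix with first row $t_{1j}=\beta_j$ for $1\le j\le n-1$ and $t_{1n}=1$; for $2\le i\le n-1$: $t_{i,i-1}=-1$, $t_{ii}=a_i$, $t_{i,i+1}=-1+\beta_i\beta_{i+1}$ if $i+1\le n-1$, $t_{ij}=\beta_i\beta_j$ for $i+2\le j\le n-1$, $t_{in}=\beta_i$, and $t_{ij}=0$ for $j\le i-2$; last row $t_{n,n-1}=-1$, $t_{nn}=\beta_n$, $t_{nj}=0$ for $j\le n-2$. That is, $$P_n=\begin{vmatrix} \beta_1 & \beta_2 & \beta_3 & \cdots & \beta_{n-1} & 1\\ -1 & a_2 & -1+\beta_2\beta_3 & \cdots & \beta_2\beta_{n-1} & \beta_2\\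 0&-1&a_3&\cdots&\beta_3\beta_{n-1}&\beta_3\\ \cdots&\cdots&\cdots&\cdots&\cdots&\cdots\\ 0&\cdots&0&-1&a_{n-1}&\beta_{n-1}\\ 0&\cdots&0&0&-1&\beta_n\end{vmatrix}_{\mathrm{col}}.$$
   Context: A supercommutative ring satisfies $xy=(-1)^{|x||y|}yx$ for homogeneous $x,y$ and $x^2=0$ for odd $x$. Rule (definition of $\mathcal{E}$): Let $w=(w_1,\ldots,w_m)$ be a word with letters among $\beta_1,\beta_2,\ldots$, and write $\iota(p)$ for the index of the letter at position $p$; in the words considered, adjacent positions satisfy $\iota(p+1)\in\{\iota(p),\iota(p)+1\}$. An admissible marking of $w$ is a partition of $\{1,\ldots,m\}$ into blocks of consecutive positions, each a singleton $\{p\}$, a pair $\{p,p+1\}$, or a quadruple $\{p,\ldots,p+3\}$ with $\iota(p)=\iota(p+1)=i$, $\iota(p+2)=\iota(p+3)=i+1$ for some $i$. The weight of a pair $\{p,p+1\}$ is $a_i$ if $\iota(p)=\iota(p+1)=i$ and $1$ if $\iota(p+1)=\iota(p)+1$; the weight of a quadruple is $-1$. The monomial of a marking is the product of the weights of its pairs and quadruples times $\beta_{\iota(p_1)}\cdots\beta_{\iota(p_k)}$, where $p_1<\cdots<p_k$ are its singleton positions in increasing order. $\mathcal{E}[w]$ is the sum of the monomials over all admissible markings (the empty word has value $1$). For example $P_2=\beta_1\beta_2+1$ and $P_3=a_2\beta_1\beta_3+\beta_1\beta_2+\beta_2\beta_3+1$. Column-expansion determinant: for a $1\times1$ matrix,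 $\det_{\mathrm{col}}(t)=t$; for a $k\times k$ matrix $T$ with $k\ge2$, $\det_{\mathrm{col}}T=\sum_{i=1}^k(-1)^{i+1}\,t_{i1}\cdot\det_{\mathrm{col}}(T^{(i,1)})$, where $T^{(i,1)}$ is $T$ with row $i$ and column $1$ deleted and the entry $t_{i1}$ is written to the left of the minor (i.e. the determinant is always expanded along the first column, recursively). *)

theory Defs
  imports "HOL-Library.Disjoint_Sets" "Jordan_Normal_Form.Determinant"
begin

(* The sort {ring, monoid_mult} is that of associative unital rings; unlike ring_1 it does not
   exclude the zero ring. *)

locale supercommutative_ring =
  fixes R :: "nat \<Rightarrow> 'a :: {ring, monoid_mult} set"
  assumes zero_closed: "i < 2 \<Longrightarrow> 0 \<in> R i"
    and add_closed: "i < 2 \<Longrightarrow> x \<in> R i \<Longrightarrow> y \<in> R i \<Longrightarrow> x + y \<in> R i"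
    and uminus_closed: "i < 2 \<Longrightarrow> x \<in> R i \<Longrightarrow> - x \<in> R i"
    and decomposition: "\<exists>u\<in>R 0. \<exists>v\<in>R 1. x = u + v"
    and trivial_intersection: "R 0 \<inter> R 1 = {0}"
    and one_even: "1 \<in> R 0"
    and mult_closed:
      "i < 2 \<Longrightarrow> j < 2 \<Longrightarrow> x \<in> R i \<Longrightarrow> y \<in> R j \<Longrightarrow> x * y \<in> R ((i + j) mod 2)"
    and supercommute:
      "i < 2 \<Longrightarrow> j < 2 \<Longrightarrow> x \<in> R i \<Longrightarrow> y \<in> R j \<Longrightarrow> x * y = (- 1) ^ (i * j) * (y * x)"
    and odd_square: "x \<in> R 1 \<Longrightarrow> x * x = 0"

(* A word in the letters beta_1, beta_2, ... is given by the list of indices of its letters;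
   positions are counted from 0. *)

definition admissible_block :: "nat list \<Rightarrow> nat set \<Rightarrow> bool" where
  "admissible_block w B \<longleftrightarrow>
     (\<exists>p. B = {p}) \<or>
     (\<exists>p. B = {p, p + 1}) \<or>
     (\<exists>p i. B = {p..p + 3} \<and> w ! p = i \<and> w ! (p + 1) = i \<and>
            w ! (p + 2) = i + 1 \<and> w ! (p + 3) = i + 1)"

definition admissible_marking :: "nat list \<Rightarrow> nat set set \<Rightarrow> bool" where
  "admissible_marking w M \<longleftrightarrow>
     partition_on {0..<length w} M \<and> (\<forall>B\<in>M. admissible_block w B)"

(* In the words considered, adjacent indices are equal or increase by one, so the last case
   below is the case of an increase by one. *)
definition pair_weight :: "(nat \<Rightarrow> 'a :: {ring, monoid_mult}) \<Rightarrow> nat list \<Rightarrow> nat \<Rightarrow> 'a" where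
  "pair_weight a w p = (if w ! p = w ! (p + 1) then a (w ! p) else 1)"

(* The weight of the pair or quadruple of M starting at p, and 1 if there is none. *)
definition weight_at ::
  "(nat \<Rightarrow> 'a :: {ring, monoid_mult}) \<Rightarrow> nat list \<Rightarrow> nat set set \<Rightarrow> nat \<Rightarrow> 'a" where
  "weight_at a w M p =
     (if {p, p + 1} \<in> M then pair_weight a w p
      else if {p..p + 3} \<in> M then - 1
      else 1)"

(* The weights are multiplied in order of position only to make the product well defined in a
   noncommutative type; for even a_i the order is immaterial. *)
definition marking_monomial ::
  "(nat \<Rightarrow> 'a :: {ring, monoid_mult}) \<Rightarrow> (nat \<Rightarrow> 'a) \<Rightarrow> nat list \<Rightarrow> nat set set \<Rightarrow> 'a" where
  "marking_monomial a \<beta> w M =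
     prod_list (map (weight_at a w M) [0..<length w]) *
     prod_list (map (\<lambda>p. \<beta> (w ! p)) (filter (\<lambda>p. {p} \<in> M) [0..<length w]))"

definition marking_sum ::
  "(nat \<Rightarrow> 'a :: {ring, monoid_mult}) \<Rightarrow> (nat \<Rightarrow> 'a) \<Rightarrow> nat list \<Rightarrow> 'a" where
  "marking_sum a \<beta> w = (\<Sum>M | admissible_marking w M. marking_monomial a \<beta> w M)"

definition P :: "(nat \<Rightarrow> 'a :: {ring, monoid_mult}) \<Rightarrow> (nat \<Rightarrow> 'a) \<Rightarrow> nat \<Rightarrow> 'a" where
  "P a \<beta> n =
     (if n \<le> 1 then 1
      else marking_sum a \<beta> ([1] @ concat (map (\<lambda>i. [i, i]) [2..<n]) @ [n]))"

definition Q :: "(nat \<Rightarrow> 'a :: {ring, monoid_mult}) \<Rightarrow> (nat \<Rightarrow> 'a) \<Rightarrow> nat \<Rightarrow> 'a" where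
  "Q a \<beta> n = marking_sum a \<beta> ([1] @ concat (map (\<lambda>i. [i, i]) [2..<n + 1]))"

(* Rows are counted from 0 here, hence the sign (-1)^i. Only meant for square matrices of
   positive size. *)
function det_col :: "'a :: {ring, monoid_mult} mat \<Rightarrow> 'a" where
  "det_col T =
     (if dim_row T = 1 then T $$ (0, 0)
      else (\<Sum>i<dim_row T. (- 1) ^ i * (T $$ (i, 0) * det_col (mat_delete T i 0))))"
  by auto
termination
  by (relation "measure dim_row") auto

declare det_col.simps [simp del]

definition T_entry ::
  "(nat \<Rightarrow> 'a :: {ring, monoid_mult}) \<Rightarrow> (nat \<Rightarrow> 'a) \<Rightarrow> nat \<Rightarrow> nat \<Rightarrow> nat \<Rightarrow> 'a" where
  "T_entry a \<beta> n i j =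
     (if i = 1 then (if j = n then 1 else \<beta> j)
      else if j + 1 < i then 0
      else if j + 1 = i then - 1
      else if j = n then \<beta> i
      else if j = i then a i
      else if j = i + 1 then - 1 + \<beta> i * \<beta> (i + 1)
      else \<beta> i * \<beta> j)"

(* T_entry uses indices from 1 to n, the matrix type indices from 0 to n - 1. *)
definition T_mat ::
  "(nat \<Rightarrow> 'a :: {ring, monoid_mult}) \<Rightarrow> (nat \<Rightarrow> 'a) \<Rightarrow> nat \<Rightarrow> 'a mat" where
  "T_mat a \<beta> n = mat n n (\<lambda>(i, j). T_entry a \<beta> n (i + 1) (j + 1))"

end

theory Submission
  imports Defs
begin

text \<open>
  Classifying the admissible markings of a word by their last block (singleton, pair or quadruple)
  gives P(n) = Q(n-1) \<beta>(n) + P(n-1) and Q(n) = P(n) \<beta>(n) + Q(n-1) a(n) - Q(n-2). Since Q(n-1)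
  is odd, the former is the first claim. The matrix is upper Hessenberg with subdiagonal entries
  -1, so its column expansion is \<Sum>i\<le>n. F(i) t(i,n), where F(1) = 1 and
  F(k+1) = \<Sum>i\<le>k. F(i) t(i,k). Because \<beta>(k)\<beta>(k) = 0, the recurrences show F(k+1) = Q(k) for
  k < n, and the last column then yields 1 + \<Sum>2\<le>i\<le>n. Q(i-1) \<beta>(i) = P(n).
\<close>

section \<open>Blocks as half-open intervals of positions\<close>

lemma atLeastLessThan_eq_singleton_iff:
  fixes l n p :: nat
  assumes "l < n"
  shows "{l..<n} = {p} \<longleftrightarrow> p = l \<and> n = l + 1"
proof -
  have "{p} = {p..<p + 1}" by auto
  then show ?thesis using assms atLeastLessThan_eq_iff[of l n p "p + 1"] by auto
qed

lemma atLeastLessThan_eq_pair_iff: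
  fixes l n p :: nat
  assumes "l < n"
  shows "{l..<n} = {p, p + 1} \<longleftrightarrow> p = l \<and> n = l + 2"
proof -
  have "{p, p + 1} = {p..<p + 2}" by auto
  then show ?thesis using assms atLeastLessThan_eq_iff[of l n p "p + 2"] by auto
qed

lemma atLeastLessThan_eq_quadruple_iff:
  fixes l n p :: nat
  assumes "l < n"
  shows "{l..<n} = {p..p + 3} \<longleftrightarrow> p = l \<and> n = l + 4"
proof -
  have "{p..p + 3} = {p..<p + 4}" by auto
  then show ?thesis using assms atLeastLessThan_eq_iff[of l n p "p + 4"] by auto
qed

text \<open>A nonempty half-open interval determines its endpoints, so the three block shapes become
  conditions on the length; only length 4 also constrains letters.\<close>

lemma admissible_block_atLeastLessThan_iff:
  assumes "l < n"
  shows "admissible_block w {l..<n} \<longleftrightarrow>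
    n = l + 1 \<or> n = l + 2 \<or>
    (n = l + 4 \<and> w ! (l + 1) = w ! l \<and> w ! (l + 2) = w ! l + 1 \<and> w ! (l + 3) = w ! l + 1)"
  unfolding admissible_block_def atLeastLessThan_eq_singleton_iff[OF assms]
    atLeastLessThan_eq_pair_iff[OF assms] atLeastLessThan_eq_quadruple_iff[OF assms]
  by auto

lemma admissible_block_cases:
  assumes "admissible_block w B"
  obtains l n where "l < n" "B = {l..<n}"
proof -
  have "{p} = {p..<p + 1}" "{p, p + 1} = {p..<p + 2}" "{p..p + 3} = {p..<p + 4}" for p :: nat
    by auto
  then obtain p where "B = {p..<p + 1} \<or> B = {p..<p + 2} \<or> B = {p..<p + 4}"
    using assms unfolding admissible_block_def by metis
  then show ?thesis using that[of p "p + 1"] that[of p "p + 2"] that[of p "p + 4"] by auto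
qed

text \<open>Admissibility reads letters only at positions of the block itself, and these lie in the
  retained prefix.\<close>

lemma admissible_block_take:
  assumes "B \<subseteq> {0..<l}"
  shows "admissible_block (take l w) B \<longleftrightarrow> admissible_block w B"
proof -
  have "take l w ! p = w ! p" if "p \<in> B" for p
    using that assms by auto
  moreover have "p \<in> {p..p + 3}" "p + 1 \<in> {p..p + 3}" "p + 2 \<in> {p..p + 3}"
    "p + 3 \<in> {p..p + 3}" for p :: nat
    by auto
  ultimately show ?thesis
    unfolding admissible_block_def by metis
qed

lemma finite_admissible_markings: "finite {M. admissible_marking w M}"
proof (rule finite_subset)
  show "{M. admissible_marking w M} \<subseteq> Pow (Pow {0..<length w})"
    by (auto simp: admissible_marking_def partition_on_def)
qed simp

text \<open>The last block is disjoint from \<open>\<Union>M\<close> and its complement is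
  \<open>{0..<l}\<close>, so the partition condition passes to the prefix; admissibility passes
  because it is local to each block.\<close>

lemma admissible_marking_insert_iff:
  assumes l: "l < length w" and M: "\<Union>M \<subseteq> {0..<l}"
  shows "admissible_marking w (insert {l..<length w} M) \<longleftrightarrow>
    admissible_block w {l..<length w} \<and> admissible_marking (take l w) M"
proof -
  have "disjnt {l..<length w} (\<Union>M)"
    using M by (force simp: disjnt_def)
  moreover have "{0..<length w} - {l..<length w} = {0..<l}"
    using l by auto
  moreover have "admissible_block (take l w) B \<longleftrightarrow> admissible_block w B" if "B \<in> M" for B
    using that M by (intro admissible_block_take) auto
  ultimately show ?thesis
    using l unfolding admissible_marking_def by (auto simp: partition_on_insert min_absorb2)
qed

section \<open>Splitting off the last block of a marking\<close>

definition final_block_starts :: "nat list \<Rightarrow> nat set" where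
  "final_block_starts w = {l. l < length w \<and> admissible_block w {l..<length w}}"

text \<open>For a singleton this is the letter, so that one factor holds all that the last block
  contributes. The closing \<open>- 1\<close> means a quadruple only for \<open>l\<close> in
  \<open>final_block_starts w\<close>.\<close>

definition final_block_weight ::
  "(nat \<Rightarrow> 'a :: {ring, monoid_mult}) \<Rightarrow> (nat \<Rightarrow> 'a) \<Rightarrow> nat list \<Rightarrow> nat \<Rightarrow> 'a" where
  "final_block_weight a \<beta> w l =
     (if length w = l + 1 then \<beta> (w ! l)
      else if length w = l + 2 then pair_weight a w l else - 1)"

text \<open>The block containing the last position is an interval inside the word, hence ends with
  the word; removing it leaves a marking of a prefix.\<close>

lemma admissible_markings_eq_UN:
  assumes "w \<noteq> []"
  shows "{M. admissible_marking w M} =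
    (\<Union>l\<in>final_block_starts w. insert {l..<length w} ` {M. admissible_marking (take l w) M})"
proof (intro subset_antisym subsetI)
  fix M assume "M \<in> {M. admissible_marking w M}"
  then have part: "partition_on {0..<length w} M" and adm: "\<And>B. B \<in> M \<Longrightarrow> admissible_block w B"
    and M: "admissible_marking w M"
    by (auto simp: admissible_marking_def)
  have "length w - 1 \<in> \<Union>M"
    using part assms by (auto simp: partition_on_def)
  then obtain B where B: "B \<in> M" "length w - 1 \<in> B" by auto
  obtain l n where ln: "l < n" "B = {l..<n}"
    using adm[OF B(1)] by (rule admissible_block_cases)
  have "{l..<n} \<subseteq> {0..<length w}"
    using part B ln by (metis Sup_upper partition_onD1)
  then have "n \<le> length w"
    using ln(1) atLeastLessThan_subset_iff[of l n 0 "length w"] by auto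
  then have n: "n = length w"
    using ln B assms by auto
  define M' where "M' = M - {B}"
  have MM': "M = insert {l..<length w} M'"
    using B ln n by (auto simp: M'_def)
  have "\<Union>M' \<subseteq> {0..<l}"
  proof
    fix p assume "p \<in> \<Union>M'"
    then obtain C where C: "C \<in> M" "C \<noteq> B" "p \<in> C" by (auto simp: M'_def)
    then have "p \<notin> B" "p < length w"
      using part B by (auto simp: partition_on_def disjoint_def)
    then show "p \<in> {0..<l}" using ln n by auto
  qed
  then have "admissible_block w {l..<length w}" "admissible_marking (take l w) M'"
    using admissible_marking_insert_iff[of l w M'] M MM' ln n by auto
  then show "M \<in> (\<Union>l\<in>final_block_starts w.
      insert {l..<length w} ` {M. admissible_marking (take l w) M})"
    using MM' ln n by (auto simp: final_block_starts_def)
next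
  fix M assume "M \<in> (\<Union>l\<in>final_block_starts w.
      insert {l..<length w} ` {M. admissible_marking (take l w) M})"
  then obtain l M' where l: "l < length w" "admissible_block w {l..<length w}"
    and M': "admissible_marking (take l w) M'" and M: "M = insert {l..<length w} M'"
    by (auto simp: final_block_starts_def)
  have "\<Union>M' \<subseteq> {0..<l}"
    using M' l by (auto simp: admissible_marking_def partition_on_def)
  then show "M \<in> {M. admissible_marking w M}"
    using l M M' by (simp add: admissible_marking_insert_iff)
qed

text \<open>In a monomial all weights stand to the left of all letters. Writing the factor of the
  last block on the right moves a pair weight past the letters, which is the use of
  \<open>central\<close>; the quadruple weight \<open>- 1\<close> commutes anyway.\<close>

lemma marking_monomial_insert:
  assumes l: "l \<in> final_block_starts w" and M: "\<Union>M \<subseteq> {0..<l}"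
    and central: "\<And>x. length w = l + 2 \<Longrightarrow> pair_weight a w l * x = x * pair_weight a w l"
  shows "marking_monomial a \<beta> w (insert {l..<length w} M) =
    marking_monomial a \<beta> (take l w) M * final_block_weight a \<beta> w l"
proof -
  define n where "n = length w"
  have ln: "l < n" and n: "n = l + 1 \<or> n = l + 2 \<or> n = l + 4"
    using l admissible_block_atLeastLessThan_iff[of l "length w" w]
    by (auto simp: final_block_starts_def n_def)
  let ?N = "insert {l..<n} M"
  have notM: "B \<notin> M" if "p \<in> B" "p \<ge> l" for p B
    using M that by auto
  have w1: "weight_at a w ?N p = weight_at a (take l w) M p" if "p < l" for p
  proof -
    \<comment> \<open>\<open>pair_weight\<close> also reads the letter at \<open>p + 1\<close>,
      which must survive the truncation to length \<open>l\<close>.\<close>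
    have "p + 1 < l" if "{p, p + 1} \<in> M" using that M by auto
    moreover have "{p, p + 1} \<noteq> {l..<n}" "{p..p + 3} \<noteq> {l..<n}"
      using \<open>p < l\<close> atLeastLessThan_eq_pair_iff[OF ln, of p]
        atLeastLessThan_eq_quadruple_iff[OF ln, of p] by auto
    ultimately show ?thesis
      using \<open>p < l\<close> by (auto simp: weight_at_def pair_weight_def)
  qed
  have pair: "{p, p + 1} \<in> ?N \<longleftrightarrow> p = l \<and> n = l + 2" if "l \<le> p" for p
    using notM[of p "{p, p + 1}"] that atLeastLessThan_eq_pair_iff[OF ln, of p]
    by (metis insertCI insertE)
  have quadruple: "{p..p + 3} \<in> ?N \<longleftrightarrow> p = l \<and> n = l + 4" if "l \<le> p" for p
    using notM[of p "{p..p + 3}"] that atLeastLessThan_eq_quadruple_iff[OF ln, of p]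
    by (metis atLeastAtMost_iff insertCI insertE le_add1 order_refl)
  have w2: "weight_at a w ?N p = 1" if "p > l" for p
    unfolding weight_at_def pair[OF less_imp_le[OF that]] quadruple[OF less_imp_le[OF that]]
    using that by simp
  have w3: "weight_at a w ?N l = (if n = l + 1 then 1 else if n = l + 2 then pair_weight a w l else - 1)"
    unfolding weight_at_def pair[OF order_refl] quadruple[OF order_refl] using n by auto
  have s1: "{p} \<in> ?N \<longleftrightarrow> {p} \<in> M" if "p < l" for p
    using that atLeastLessThan_eq_singleton_iff[OF ln, of p] by (metis insert_iff less_irrefl)
  have s2: "{p} \<in> ?N \<longleftrightarrow> p = l \<and> n = l + 1" if "l \<le> p" for p
    using notM[of p "{p}"] that atLeastLessThan_eq_singleton_iff[OF ln, of p]
    by (metis insertCI insertE)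
  have split: "[0..<n] = [0..<l] @ [l] @ [Suc l..<n]"
    using ln upt_add_eq_append[of 0 l "n - l"] by (simp add: upt_conv_Cons)
  have one: "prod_list (map (weight_at a w ?N) [Suc l..<n]) = 1"
  proof -
    have "map (weight_at a w ?N) [Suc l..<n] = map (\<lambda>_. 1) [Suc l..<n]"
      using w2 by (intro map_cong) auto
    then show ?thesis by (simp add: map_replicate_const)
  qed
  have weights: "prod_list (map (weight_at a w ?N) [0..<n]) =
      prod_list (map (weight_at a (take l w) M) [0..<l]) * weight_at a w ?N l"
  proof -
    have "map (weight_at a w ?N) [0..<l] = map (weight_at a (take l w) M) [0..<l]"
      using w1 by (intro map_cong) auto
    then show ?thesis
      unfolding split
      by (simp only: map_append prod_list.append list.map prod_list.Cons prod_list.Nil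
          one mult_1_right)
  qed
  have "filter (\<lambda>p. {p} \<in> ?N) [Suc l..<n] = []"
    using s2 by (auto simp: filter_empty_conv simp del: insert_iff)
  moreover have "filter (\<lambda>p. {p} \<in> ?N) [0..<l] = filter (\<lambda>p. {p} \<in> M) [0..<l]"
    using s1 by (intro filter_cong) (simp_all del: insert_iff)
  ultimately have "filter (\<lambda>p. {p} \<in> ?N) [0..<n] =
      filter (\<lambda>p. {p} \<in> M) [0..<l] @ (if n = l + 1 then [l] else [])"
    unfolding split filter_append using s2[of l] by (simp del: insert_iff)
  moreover have "map (\<lambda>p. \<beta> (w ! p)) (filter (\<lambda>p. {p} \<in> M) [0..<l]) =
      map (\<lambda>p. \<beta> (take l w ! p)) (filter (\<lambda>p. {p} \<in> M) [0..<l])"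
    by (intro map_cong) auto
  ultimately have letters: "prod_list (map (\<lambda>p. \<beta> (w ! p)) (filter (\<lambda>p. {p} \<in> ?N) [0..<n])) =
      prod_list (map (\<lambda>p. \<beta> (take l w ! p)) (filter (\<lambda>p. {p} \<in> M) [0..<l])) *
      (if n = l + 1 then \<beta> (w ! l) else 1)"
    by (simp only: map_append prod_list.append) simp
  have len: "length (take l w) = l" using ln n_def by simp
  let ?W = "prod_list (map (weight_at a (take l w) M) [0..<l])"
  let ?B = "prod_list (map (\<lambda>p. \<beta> (take l w ! p)) (filter (\<lambda>p. {p} \<in> M) [0..<l]))"
  have "?W * weight_at a w ?N l * (?B * (if n = l + 1 then \<beta> (w ! l) else 1)) =
      ?W * ?B * final_block_weight a \<beta> w l"
  proof (cases "n = l + 2")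
    case True
    then have "pair_weight a w l * ?B = ?B * pair_weight a w l"
      by (intro central) (simp add: n_def[symmetric])
    then show ?thesis
      unfolding w3 using True by (simp add: final_block_weight_def n_def[symmetric] mult.assoc)
  next
    case False
    then show ?thesis
      unfolding w3 by (simp add: final_block_weight_def n_def[symmetric] mult.assoc)
  qed
  then show ?thesis
    by (simp only: marking_monomial_def len n_def[symmetric] weights letters)
qed

lemma finite_final_block_starts: "finite (final_block_starts w)"
  by (simp add: final_block_starts_def)

text \<open>Markings are sorted by the start of their last block. The classes are disjoint and
  insertion is injective, because a marking of the prefix of length \<open>l\<close> has no block
  meeting a position from \<open>l\<close> on.\<close>

lemma marking_sum_eq_sum_final_block:
  assumes "w \<noteq> []"
    and central: "\<And>l x. length w = l + 2 \<Longrightarrow> pair_weight a w l * x = x * pair_weight a w l"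
  shows "marking_sum a \<beta> w =
    (\<Sum>l\<in>final_block_starts w. marking_sum a \<beta> (take l w) * final_block_weight a \<beta> w l)"
proof -
  let ?A = "\<lambda>l. {M. admissible_marking (take l w) M}"
  have sub: "\<Union>M \<subseteq> {0..<l}" if "M \<in> ?A l" for l M
    using that by (auto simp: admissible_marking_def partition_on_def)
  have notin: "B \<notin> M" if "M \<in> ?A l" "p \<in> B" "l \<le> p" for B M l p
    using sub[OF that(1)] that(2,3) by (meson UnionI atLeastLessThan_iff not_le subsetD)
  have disj: "insert {l..<length w} ` ?A l \<inter> insert {l'..<length w} ` ?A l' = {}"
    if "l \<in> final_block_starts w" "l' \<in> final_block_starts w" "l < l'" for l l'
  proof -
    have "insert {l..<length w} M \<noteq> insert {l'..<length w} M'" if "M \<in> ?A l" "M' \<in> ?A l'" for M M'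
    proof
      assume eq: "insert {l..<length w} M = insert {l'..<length w} M'"
      have "{l'..<length w} \<noteq> {l..<length w}"
        using \<open>l < l'\<close> \<open>l' \<in> _\<close> atLeastLessThan_eq_iff[of l' "length w" l "length w"]
        by (auto simp: final_block_starts_def)
      then have "{l'..<length w} \<in> M" using eq by blast
      moreover have "{l'..<length w} \<notin> M"
        using that \<open>l < l'\<close> \<open>l' \<in> _\<close> by (intro notin[of M l l']) (auto simp: final_block_starts_def)
      ultimately show False by simp
    qed
    then show ?thesis by blast
  qed
  have inj: "inj_on (insert {l..<length w}) (?A l)" if "l \<in> final_block_starts w" for l
  proof (rule inj_onI)
    fix M M' assume *: "M \<in> ?A l" "M' \<in> ?A l" "insert {l..<length w} M = insert {l..<length w} M'"
    have "{l..<length w} \<notin> M" "{l..<length w} \<notin> M'"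
      using notin[OF *(1), of l] notin[OF *(2), of l] that by (auto simp: final_block_starts_def)
    then show "M = M'" using *(3) by (metis insert_ident)
  qed
  have "marking_sum a \<beta> w =
      (\<Sum>l\<in>final_block_starts w. \<Sum>N\<in>insert {l..<length w} ` ?A l. marking_monomial a \<beta> w N)"
    unfolding marking_sum_def admissible_markings_eq_UN[OF assms(1)]
  proof (rule sum.UNION_disjoint)
    show "\<forall>l\<in>final_block_starts w. \<forall>l'\<in>final_block_starts w. l \<noteq> l' \<longrightarrow>
        insert {l..<length w} ` ?A l \<inter> insert {l'..<length w} ` ?A l' = {}"
      using disj by (metis Int_commute linorder_neqE_nat)
  qed (auto simp: finite_final_block_starts finite_admissible_markings)
  also have "\<dots> = (\<Sum>l\<in>final_block_starts w. \<Sum>M\<in>?A l.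
      marking_monomial a \<beta> (take l w) M * final_block_weight a \<beta> w l)"
  proof (rule sum.cong[OF refl])
    fix l assume l: "l \<in> final_block_starts w"
    show "(\<Sum>N\<in>insert {l..<length w} ` ?A l. marking_monomial a \<beta> w N) =
        (\<Sum>M\<in>?A l. marking_monomial a \<beta> (take l w) M * final_block_weight a \<beta> w l)"
      unfolding sum.reindex[OF inj[OF l]] o_def
      using l sub central by (intro sum.cong refl marking_monomial_insert) auto
  qed
  finally show ?thesis
    by (simp add: marking_sum_def sum_distrib_right)
qed

section \<open>Marking sums of words with prescribed endings\<close>

lemma marking_sum_Nil: "marking_sum a \<beta> [] = 1"
proof -
  have "{M. admissible_marking [] M} = {{}}"
    by (auto simp: admissible_marking_def partition_on_def)
  then show ?thesis by (simp add: marking_sum_def marking_monomial_def)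
qed

lemma final_block_starts_eq:
  "final_block_starts w = {l. length w = l + 1 \<or> length w = l + 2 \<or>
     (length w = l + 4 \<and> w ! (l + 1) = w ! l \<and> w ! (l + 2) = w ! l + 1 \<and> w ! (l + 3) = w ! l + 1)}"
  unfolding final_block_starts_def using admissible_block_atLeastLessThan_iff[of _ "length w" w]
  by (auto; fastforce)

lemma marking_sum_singleton: "marking_sum a \<beta> [x] = \<beta> x"
proof -
  have "final_block_starts [x] = {0}" by (auto simp: final_block_starts_eq)
  then show ?thesis
    by (subst marking_sum_eq_sum_final_block)
      (simp_all add: marking_sum_Nil final_block_weight_def)
qed

text \<open>A final quadruple would need equal last letters, so the word ends in a singleton or in a
  pair, whose weight is 1.\<close>

lemma marking_sum_snoc_distinct:
  assumes "x \<noteq> y"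
  shows "marking_sum a \<beta> (u @ [x, y]) = marking_sum a \<beta> (u @ [x]) * \<beta> y + marking_sum a \<beta> u"
proof -
  have "final_block_starts (u @ [x, y]) = {length u + 1, length u}"
    using assms by (auto simp: final_block_starts_eq nth_append)
  then show ?thesis
    using assms
    by (subst marking_sum_eq_sum_final_block)
      (auto simp: final_block_weight_def pair_weight_def nth_append)
qed


text \<open>Three letters leave no room for a quadruple.\<close>

lemma marking_sum_three_letters:
  assumes "\<And>c. a z * c = c * a z"
  shows "marking_sum a \<beta> [x, z, z] =
    marking_sum a \<beta> [x, z] * \<beta> z + marking_sum a \<beta> [x] * a z"
proof -
  have "final_block_starts [x, z, z] = {2, 1}"
    by (auto simp: final_block_starts_eq)
  then show ?thesis
    using assms
    by (subst marking_sum_eq_sum_final_block)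
      (auto simp: final_block_weight_def pair_weight_def numeral_2_eq_2)
qed

text \<open>The summands come from a final singleton, a final pair of weight
  \<open>a (i + 1)\<close> and a final quadruple of weight \<open>- 1\<close>.\<close>

lemma marking_sum_snoc_quadruple:
  assumes "\<And>c. a (i + 1) * c = c * a (i + 1)"
  shows "marking_sum a \<beta> (u @ [i, i, i + 1, i + 1]) =
    marking_sum a \<beta> (u @ [i, i, i + 1]) * \<beta> (i + 1) +
    marking_sum a \<beta> (u @ [i, i]) * a (i + 1) - marking_sum a \<beta> u"
proof -
  have "final_block_starts (u @ [i, i, i + 1, i + 1]) = {length u + 3, length u + 2, length u}"
    using assms by (auto simp: final_block_starts_eq nth_append)
  then show ?thesis
    using assms
    by (subst marking_sum_eq_sum_final_block)
      (auto simp: final_block_weight_def pair_weight_def nth_append)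
qed

section \<open>Column expansion of upper Hessenberg matrices\<close>

text \<open>
  The minors met when expanding an upper Hessenberg matrix along first columns: columns
  \<open>k, \<dots>, k + m - 1\<close>, with row \<open>i\<close> on top of the rows \<open>k + 1, \<dots>, k + m - 1\<close>.
\<close>

definition hessenberg ::
  "(nat \<Rightarrow> nat \<Rightarrow> 'a :: {ring, monoid_mult}) \<Rightarrow> nat \<Rightarrow> nat \<Rightarrow> nat \<Rightarrow> 'a mat" where
  "hessenberg t i k m = mat m m (\<lambda>(r, c). t (if r = 0 then i else k + r) (k + c))"

lemma det_col_hessenberg_one: "det_col (hessenberg t i k 1) = t i k"
  by (simp add: det_col.simps hessenberg_def)

text \<open>Only the top two entries of the first column can be nonzero. The sign of the second row
  cancels its entry \<open>- 1\<close>, and deleting that row keeps row \<open>i\<close> on top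
  while the columns move on by one.\<close>

lemma det_col_hessenberg_Suc:
  assumes "t (k + 1) k = - 1" and "\<And>r. r \<ge> 2 \<Longrightarrow> t (k + r) k = 0" and "m \<ge> 1"
  shows "det_col (hessenberg t i k (Suc m)) =
    t i k * det_col (hessenberg t (k + 1) (k + 1) m) + det_col (hessenberg t i (k + 1) m)"
proof -
  let ?H = "hessenberg t i k (Suc m)"
  have minor0: "mat_delete ?H 0 0 = hessenberg t (k + 1) (k + 1) m"
    by (rule eq_matI) (auto simp: mat_delete_def hessenberg_def)
  have minor1: "mat_delete ?H 1 0 = hessenberg t i (k + 1) m"
    by (rule eq_matI) (auto simp: mat_delete_def hessenberg_def)
  obtain m' where m': "m = Suc m'" using \<open>m \<ge> 1\<close> by (cases m) auto
  let ?f = "\<lambda>r. (- 1) ^ r * (?H $$ (r, 0) * det_col (mat_delete ?H r 0))"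
  have entry: "?H $$ (r, 0) = t (if r = 0 then i else k + r) k" if "r < Suc m" for r
    using that by (simp add: hessenberg_def)
  have dim: "dim_row ?H = Suc m" by (simp add: hessenberg_def)
  have "det_col ?H = sum ?f {..<Suc m}"
    using \<open>m \<ge> 1\<close> by (subst det_col.simps) (simp add: dim)
  also have "\<dots> = ?f 0 + (?f 1 + (\<Sum>r<m'. ?f (Suc (Suc r))))"
    unfolding m' by (simp add: sum.lessThan_Suc_shift del: sum.lessThan_Suc)
  also have "(\<Sum>r<m'. ?f (Suc (Suc r))) = 0"
  proof (rule sum.neutral, rule ballI)
    fix r assume "r \<in> {..<m'}"
    then show "?f (Suc (Suc r)) = 0"
      using assms(2)[of "Suc (Suc r)"] m' entry[of "Suc (Suc r)"] by simp
  qed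
  finally show ?thesis
    using assms(1) \<open>m \<ge> 1\<close> by (simp add: entry minor0 minor1 minor1[simplified])
qed

text \<open>\<open>F k\<close> collects the products of top-row entries over all ways of expanding
  columns before \<open>k\<close> that bring row \<open>k\<close> to the top. New entries join on
  the right, in the order in which \<open>det_col\<close> writes them, so factors are never
  permuted.\<close>

lemma det_col_hessenberg_eq_sum:
  assumes sub: "\<And>k. k \<ge> 1 \<Longrightarrow> t (k + 1) k = - 1"
    and zero: "\<And>k r. k \<ge> 1 \<Longrightarrow> r \<ge> 2 \<Longrightarrow> t (k + r) k = 0"
    and F: "\<And>k. 1 \<le> k \<Longrightarrow> k < n \<Longrightarrow> F (k + 1) = (\<Sum>i=1..k. F i * t i k)"
    and "F 1 = 1" and "n \<ge> 1"
  shows "det_col (hessenberg t 1 1 n) = (\<Sum>i=1..n. F i * t i n)"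
proof -
  \<comment> \<open>This weighted sum of minors is independent of \<open>k\<close>; \<open>k = 1\<close> is the determinant and
    \<open>k = n\<close> the right-hand side.\<close>
  have "(\<Sum>i=1..k. F i * det_col (hessenberg t i k (Suc m))) = (\<Sum>i=1..n. F i * t i n)"
    if "k \<ge> 1" "k + m = n" for k m
    using that
  proof (induction m arbitrary: k)
    case 0
    then show ?case using det_col_hessenberg_one[of t] by simp
  next
    case (Suc m)
    have "(\<Sum>i=1..k. F i * det_col (hessenberg t i k (Suc (Suc m)))) =
        (\<Sum>i=1..k. F i * t i k) * det_col (hessenberg t (k + 1) (k + 1) (Suc m)) +
        (\<Sum>i=1..k. F i * det_col (hessenberg t i (k + 1) (Suc m)))"
      using Suc.prems sub zero
      by (simp add: det_col_hessenberg_Suc distrib_left sum.distrib sum_distrib_right mult.assoc)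
    \<comment> \<open>Choosing the top entry of column \<open>k\<close> makes row
      \<open>k + 1\<close> the new top row; its total coefficient is \<open>F (k + 1)\<close>, which
      supplies the summand with index \<open>k + 1\<close>.\<close>
    also have "(\<Sum>i=1..k. F i * t i k) = F (k + 1)"
      using F Suc.prems by simp
    also have "F (k + 1) * det_col (hessenberg t (k + 1) (k + 1) (Suc m)) +
        (\<Sum>i=1..k. F i * det_col (hessenberg t i (k + 1) (Suc m))) =
        (\<Sum>i=1..k + 1. F i * det_col (hessenberg t i (k + 1) (Suc m)))"
      by (simp add: add.commute)
    also have "\<dots> = (\<Sum>i=1..n. F i * t i n)"
      using Suc.prems by (intro Suc.IH) auto
    finally show ?case .
  qed
  from this[of 1 "n - 1"] show ?thesis
    using assms(4,5) by simp
qed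

lemma T_mat_eq_hessenberg: "T_mat a \<beta> n = hessenberg (T_entry a \<beta> n) 1 1 n"
  by (rule eq_matI) (auto simp: T_mat_def hessenberg_def)

section \<open>Recurrences for \<open>P\<close> and \<open>Q\<close>\<close>

lemma P_1: "P a \<beta> 1 = 1"
  by (simp add: P_def)

lemma Q_1: "Q a \<beta> 1 = \<beta> 1"
  by (simp add: Q_def marking_sum_singleton)

lemma P_eq_marking_sum:
  "n \<ge> 2 \<Longrightarrow> P a \<beta> n = marking_sum a \<beta> ([1] @ concat (map (\<lambda>i. [i, i]) [2..<n]) @ [n])"
  by (simp add: P_def)

text \<open>The word of \<open>P a \<beta> (n + 1)\<close> ends in the distinct letters
  \<open>n\<close>, \<open>n + 1\<close>: dropping one letter leaves the word of
  \<open>Q a \<beta> n\<close>, dropping two that of \<open>P a \<beta> n\<close>.\<close>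

lemma P_Suc:
  assumes "n \<ge> 1"
  shows "P a \<beta> (n + 1) = Q a \<beta> n * \<beta> (n + 1) + P a \<beta> n"
proof (cases "n = 1")
  case True
  \<comment> \<open>Dropping two letters here leaves the empty word, whose value 1 agrees with the
    convention for \<open>P a \<beta> 1\<close>.\<close>
  have "P a \<beta> 2 = marking_sum a \<beta> ([] @ [1, 2])"
    by (simp add: P_eq_marking_sum)
  also have "\<dots> = Q a \<beta> 1 * \<beta> 2 + P a \<beta> 1"
    by (subst marking_sum_snoc_distinct)
      (simp_all add: Q_1 P_1 marking_sum_singleton marking_sum_Nil del: One_nat_def)
  finally show ?thesis using True by (simp only: one_add_one)
next
  case False
  then have n: "n \<ge> 2" using assms by simp
  let ?u = "[1] @ concat (map (\<lambda>i. [i, i]) [2..<n]) @ [n]"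
  have "P a \<beta> (n + 1) = marking_sum a \<beta> (?u @ [n, n + 1])"
    using n by (simp add: P_eq_marking_sum)
  also have "\<dots> = marking_sum a \<beta> (?u @ [n]) * \<beta> (n + 1) + marking_sum a \<beta> ?u"
    by (rule marking_sum_snoc_distinct) simp
  also have "marking_sum a \<beta> (?u @ [n]) = Q a \<beta> n"
    using n by (simp add: Q_def)
  also have "marking_sum a \<beta> ?u = P a \<beta> n"
    using n by (simp only: P_eq_marking_sum)
  finally show ?thesis .
qed

text \<open>The letter with index 1 occurs only once, so there is no quadruple. The general
  recurrence would subtract \<open>Q a \<beta> 0\<close>, which by its definition is
  \<open>\<beta> 1\<close> and not 0.\<close>

lemma Q_2:
  assumes "\<And>c. a 2 * c = c * a 2"
  shows "Q a \<beta> 2 = P a \<beta> 2 * \<beta> 2 + Q a \<beta> 1 * a 2"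
proof -
  have "Q a \<beta> 2 = marking_sum a \<beta> [1, 2, 2]" "P a \<beta> 2 = marking_sum a \<beta> [1, 2]"
    "Q a \<beta> 1 = marking_sum a \<beta> [1]"
    by (simp_all add: Q_def P_eq_marking_sum)
  then show ?thesis by (simp only: marking_sum_three_letters[of a 2, OF assms])
qed

text \<open>From \<open>n = 2\<close> on the word ends in \<open>n, n, n + 1, n + 1\<close>;
  removing this quadruple leaves the word of \<open>Q a \<beta> (n - 1)\<close>.\<close>

lemma Q_Suc:
  assumes "n \<ge> 2" and "\<And>c. a (n + 1) * c = c * a (n + 1)"
  shows "Q a \<beta> (n + 1) = P a \<beta> (n + 1) * \<beta> (n + 1) + Q a \<beta> n * a (n + 1) - Q a \<beta> (n - 1)"
proof -
  let ?u = "[1] @ concat (map (\<lambda>i. [i, i]) [2..<n])"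
  have "Q a \<beta> (n + 1) = marking_sum a \<beta> (?u @ [n, n, n + 1, n + 1])"
    "P a \<beta> (n + 1) = marking_sum a \<beta> (?u @ [n, n, n + 1])"
    "Q a \<beta> n = marking_sum a \<beta> (?u @ [n, n])"
    "Q a \<beta> (n - 1) = marking_sum a \<beta> ?u"
    using assms(1) by (simp_all add: Q_def P_eq_marking_sum)
  then show ?thesis by (simp only: marking_sum_snoc_quadruple[of a n, OF assms(2)])
qed

section \<open>Commutation of even and odd elements\<close>

context supercommutative_ring
begin

text \<open>Splitting \<open>c\<close> into its even and odd parts extends the rule for homogeneous
  elements, with sign +1 for both parts. This yields the centrality of \<open>a i\<close> that the
  recurrences for \<open>Q\<close> demand.\<close>

lemma even_commute:
  assumes "x \<in> R 0"
  shows "x * c = c * x"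
proof -
  obtain u v where uv: "u \<in> R 0" "v \<in> R 1" "c = u + v" using decomposition by blast
  have "x * u = (- 1) ^ (0 * 0) * (u * x)" "x * v = (- 1) ^ (0 * 1) * (v * x)"
    using assms uv by (intro supercommute; simp)+
  then have "x * u + x * v = u * x + v * x" by (simp only: mult_zero_left power_0 mult_1_left)
  then show ?thesis by (simp only: uv distrib_left distrib_right)
qed

lemma odd_anticommute:
  assumes "x \<in> R 1" "y \<in> R 1"
  shows "x * y = - (y * x)"
proof -
  have "x * y = (- 1) ^ (1 * 1) * (y * x)"
    using assms by (intro supercommute) auto
  also have "\<dots> = - (y * x)" by simp
  finally show ?thesis .
qed

end

section \<open>Parity, the first identity, and evaluation of the determinant\<close>

theorem theorem3:
  fixes R :: "nat \<Rightarrow> 'a :: {ring, monoid_mult} set"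
    and a \<beta> :: "nat \<Rightarrow> 'a"
  assumes "supercommutative_ring R"
    and "\<And>i. i \<ge> 2 \<Longrightarrow> a i \<in> R 0"
    and "\<And>i. i \<ge> 1 \<Longrightarrow> \<beta> i \<in> R 1"
  shows "(\<forall>n\<ge>2. P a \<beta> n = - \<beta> n * Q a \<beta> (n - 1) + P a \<beta> (n - 1)) \<and>
         (\<forall>n\<ge>2. P a \<beta> n = det_col (T_mat a \<beta> n))"
proof -
  interpret supercommutative_ring R by fact
  have comm: "a i * c = c * a i" if "i \<ge> 2" for i c
    using assms(2) that by (intro even_commute)
  have square: "x * \<beta> i * \<beta> i = 0" if "i \<ge> 1" for i x
    using odd_square[OF assms(3)[OF that]] by (simp add: mult.assoc)
  \<comment> \<open>The parities are proved together since each recurrence mixes \<open>P\<close>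
    and \<open>Q\<close>; the induction is strong because that of \<open>Q\<close> reaches back two
    steps. Oddness of \<open>Q\<close> gives the sign in the first identity.\<close>
  have parity: "P a \<beta> n \<in> R 0 \<and> Q a \<beta> n \<in> R 1" if "n \<ge> 1" for n
    using that
  proof (induction n rule: less_induct)
    case (less n)
    have odd_mult: "x * y \<in> R 0" if "x \<in> R 1" "y \<in> R 1" for x y
      using mult_closed[of 1 1 x y] that by simp
    have mult_odd_even: "x * y \<in> R 1" "y * x \<in> R 1" if "x \<in> R 1" "y \<in> R 0" for x y
      using mult_closed[of 1 0 x y] mult_closed[of 0 1 y x] that by simp_all
    consider "n = 1" | "n = 2" | m where "n = m + 1" "m \<ge> 2"
    proof -
      have "n = 1 \<or> n = 2 \<or> n = (n - 1) + 1 \<and> n - 1 \<ge> 2" using less.prems by linarith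
      then show thesis using that by blast
    qed
    then show ?case
    proof cases
      case 1
      then show ?thesis using one_even assms(3)[of 1] P_1[of a \<beta>] Q_1[of a \<beta>] by simp
    next
      case 2
      have "P a \<beta> 2 \<in> R 0"
        using P_Suc[of 1 a \<beta>] less.IH[of 1] 2 assms(3)[of 2] odd_mult add_closed[of 0]
        by (simp add: numeral_2_eq_2)
      then show ?thesis
        using 2 Q_2[of a \<beta>] comm[of 2] less.IH[of 1] assms(2)[of 2] assms(3)[of 2] mult_odd_even
          add_closed[of 1] by simp
    next
      case 3
      have P: "P a \<beta> n \<in> R 0"
        using P_Suc[of m a \<beta>] less.IH[of m] 3 assms(3)[of n] odd_mult add_closed[of 0] by simp
      have "Q a \<beta> n = P a \<beta> n * \<beta> n + Q a \<beta> m * a n + - Q a \<beta> (m - 1)"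
        using Q_Suc[of m a \<beta>] comm[of n] 3 by simp
      also have "\<dots> \<in> R 1"
        using less.IH[of m] less.IH[of "m - 1"] P 3 assms(2)[of n] assms(3)[of n] mult_odd_even
        by (intro add_closed uminus_closed) auto
      finally show ?thesis using P by simp
    qed
  qed
  have "P a \<beta> n = - \<beta> n * Q a \<beta> (n - 1) + P a \<beta> (n - 1)" if "n \<ge> 2" for n
    using P_Suc[of "n - 1" a \<beta>] odd_anticommute[of "Q a \<beta> (n - 1)" "\<beta> n"] parity[of "n - 1"]
      assms(3)[of n] that
    by simp
  moreover have "P a \<beta> n = det_col (T_mat a \<beta> n)" if "n \<ge> 2" for n
  proof -
    let ?t = "T_entry a \<beta> n"
    \<comment> \<open>\<open>F 1\<close> is the starting value 1 of the Hessenberg recursion;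
      \<open>Q a \<beta> 0\<close> would be \<open>\<beta> 1\<close> instead.\<close>
    define F where "F i = (if i = 1 then 1 else Q a \<beta> (i - 1))" for i
    have P_sum: "P a \<beta> (m + 1) = 1 + (\<Sum>i=2..m + 1. F i * \<beta> i)" for m
    proof (induction m)
      case 0
      then show ?case by (simp add: P_def)
    next
      case (Suc m)
      have "F (m + 2) = Q a \<beta> (m + 1)" by (simp add: F_def)
      then show ?case using P_Suc[of "m + 1" a \<beta>] Suc by (simp add: add.assoc add.commute add.left_commute)
    qed
    have head: "sum g {1..k} = g 1 + sum g {2..k}" if "k \<ge> 1" for g :: "nat \<Rightarrow> 'a" and k
      using that by (simp add: sum.atLeast_Suc_atMost numeral_2_eq_2)
    have "F (k + 1) = (\<Sum>i=1..k. F i * ?t i k)" if "1 \<le> k" "k < n" for k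
    proof -
      consider "k = 1" | "k = 2" | m where "k = m + 1" "m \<ge> 2"
      proof -
        have "k = 1 \<or> k = 2 \<or> k = (k - 1) + 1 \<and> k - 1 \<ge> 2" using \<open>1 \<le> k\<close> by linarith
        then show thesis using that by blast
      qed
      then show ?thesis
      proof cases
        case 1
        then show ?thesis using that Q_1[of a \<beta>] by (simp add: F_def T_entry_def)
      next
        case 2
        \<comment> \<open>\<open>P a \<beta> 2\<close> is \<open>\<beta> 1 * \<beta> 2 + 1\<close>,
          and the first term is killed by the second factor \<open>\<beta> 2\<close>.\<close>
        have "P a \<beta> 2 * \<beta> 2 = \<beta> 2"
          using P_Suc[of 1 a \<beta>] square[of 2] P_1[of a \<beta>] by (simp add: numeral_2_eq_2 distrib_right)
        then show ?thesis
          using 2 that Q_2[of a \<beta>] comm[of 2] by (simp add: F_def T_entry_def numeral_2_eq_2)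
      next
        case 3
        \<comment> \<open>Down to the diagonal, column \<open>k\<close> has \<open>\<beta> k\<close>
          in row 1, \<open>\<beta> i * \<beta> k\<close> in rows 2 to \<open>m - 1\<close>,
          \<open>- 1 + \<beta> m * \<beta> k\<close> in row \<open>m\<close> and \<open>a k\<close>
          in row \<open>k\<close>.\<close>
        have Fm: "F m = Q a \<beta> (m - 1)" "F k = Q a \<beta> m" "F (k + 1) = Q a \<beta> k"
          using 3 by (simp_all add: F_def)
        have t: "?t 1 k = \<beta> k" "?t k k = a k" "?t m k = - 1 + \<beta> m * \<beta> k"
          using 3 that by (simp_all add: T_entry_def)
        have mid: "F i * ?t i k = F i * \<beta> i * \<beta> k" if "i \<in> {2..m - 1}" for i
          using that 3 \<open>k < n\<close> by (auto simp: T_entry_def mult.assoc)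
        have "{2..k} = insert k (insert m {2..m - 1})"
          using 3 by auto
        then have "(\<Sum>i=2..k. F i * ?t i k) =
            F k * ?t k k + (F m * ?t m k + (\<Sum>i=2..m - 1. F i * ?t i k))"
          using 3 by simp
        also have "(\<Sum>i=2..m - 1. F i * ?t i k) = (\<Sum>i=2..m - 1. F i * \<beta> i) * \<beta> k"
          using mid by (simp add: sum_distrib_right)
        finally have sum: "(\<Sum>i=1..k. F i * ?t i k) =
            \<beta> k + (F k * a k + (F m * (- 1 + \<beta> m * \<beta> k) + (\<Sum>i=2..m - 1. F i * \<beta> i) * \<beta> k))"
          using head[of k] 3 t by (simp add: F_def)
        have "{2..m} = insert m {2..m - 1}" using 3 by auto
        then have Pm: "P a \<beta> m = 1 + (F m * \<beta> m + (\<Sum>i=2..m - 1. F i * \<beta> i))"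
          using P_sum[of "m - 1"] 3 by simp
        \<comment> \<open>The term \<open>Q a \<beta> m * \<beta> k\<close> of
          \<open>P a \<beta> k\<close> dies against another \<open>\<beta> k\<close>. Lowering the
          index to \<open>m\<close> matches the column, which has no product
          \<open>\<beta> k * \<beta> k\<close> on its diagonal.\<close>
        have "P a \<beta> k * \<beta> k = P a \<beta> m * \<beta> k"
          using P_Suc[of m a \<beta>] square[of k] 3 by (simp add: distrib_right)
        then have "F (k + 1) = P a \<beta> m * \<beta> k + F k * a k - F m"
          using Q_Suc[of m a \<beta>] comm[of k] Fm 3 by simp
        \<comment> \<open>\<open>P a \<beta> m * \<beta> k\<close> accounts for row 1 and all
          products \<open>F i * \<beta> i * \<beta> k\<close>, \<open>F k * a k\<close> for the
          diagonal, and \<open>- F m\<close> for the \<open>- 1\<close> in row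
          \<open>m\<close>.\<close>
        also have "\<dots> = (\<Sum>i=1..k. F i * ?t i k)"
          unfolding sum Pm by (simp add: algebra_simps)
        finally show ?thesis .
      qed
    qed
    then have "det_col (T_mat a \<beta> n) = (\<Sum>i=1..n. F i * ?t i n)"
      unfolding T_mat_eq_hessenberg using that
      by (intro det_col_hessenberg_eq_sum) (auto simp: F_def T_entry_def)
    \<comment> \<open>In the last column the top entry 1 and the entries \<open>\<beta> i\<close>
      below it, the diagonal included, reproduce the telescoped form \<open>P_sum\<close> of
      \<open>P a \<beta> n\<close>.\<close>
    also have "\<dots> = 1 + (\<Sum>i=2..n. F i * ?t i n)"
      using head[of n] that by (simp add: F_def T_entry_def)
    also have "(\<Sum>i=2..n. F i * ?t i n) = (\<Sum>i=2..n. F i * \<beta> i)"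
      by (intro sum.cong) (auto simp: T_entry_def)
    also have "1 + \<dots> = P a \<beta> n"
      using P_sum[of "n - 1"] that by simp
    finally show ?thesis by simp
  qed
  ultimately show ?thesis by blast
qed

end
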